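(* Let $\alpha>0$, $\beta>0$, $p\in[0,1]$, and let $X\sim\mathrm{RTUOMG}(\alpha,\beta,p)$. Then the $r$th inverted moment of $X$, defined by $\mu^*_r=\int_0^1 x^{-r} f_X(x;\alpha,\beta,p)\,dx$, is $$\begin{aligned} \mu^*_{r}=\;& 2\alpha(1-p)\, B\Big(1-\frac{r}{\beta}, \alpha\Big)\;{}_{2}F_{1} \Big(\alpha+1,1-\frac{r}{\beta}; 1-\frac{r}{\beta}+\alpha;-1\Big) \\ & + 4p\alpha^2 \sum_{k=1}^{\infty}\left[\frac{1}{2k-1}\, B\Big(2k-\frac{r}{\beta}, \alpha\Big)\;{}_{2}F_{1} \Big(\alpha+1,2k-\frac{r}{\beta}; 2k-\frac{r}{\beta}+\alpha;-1\Big)\right]. \end{aligned}$$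
   Context: For $\alpha,\beta>0$ and $0<x<1$ write $$\omega_{1}^{(-2\alpha,\beta)}(x)=\left(\frac{1+x^\beta}{1-x^\beta}\right)^{-\alpha}.$$ A random variable $X$ has the record-based transmuted unit omega distribution $\mathrm{RTUOMG}(\alpha,\beta,p)$, with $\alpha>0$, $\beta>0$, $p\in[0,1]$, if it is supported on $(0,1)$ with density $$f_{X}(x;\alpha,\beta,p)=\left(\frac{2\alpha\beta x^{\beta-1}}{1-x^{2\beta}}\right)\omega_{1}^{(-2\alpha,\beta)}(x)\left[ 1-p-p \log \left(\omega_{1}^{(-2\alpha,\beta)}(x)\right) \right],\qquad 0<x<1.$$ $B(a,b)=\int_0^1 t^{a-1}(1-t)^{b-1}\,dt$ is the beta function. ${}_2F_1(a,b;c;x)$ is the Gauss hypergeometric function, ${}_2F_1(a,b;c;x)=\sum_{i=0}^\infty \frac{(a)_i(b)_i}{(c)_i}\frac{x^i}{i!}$ with $(n)_i=n(n+1)\cdots(n+i-1)$, $(n)_0=1$, understood by its usual analytic continuation where the series does not converge; for $\lambda>0$ and $\mu>0$ it satisfies $\int_0^1 x^{\lambda-1}(1-x)^{\mu-1}(1-zx)^{-\nu}\,dx=B(\lambda,\mu)\,{}_2F_1(\nu,\lambda;\lambda+\mu;z)$, used here with $z=-1$.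
   Formalization: The order r is a real number assumed to satisfy r < β, or p = 1 and r < 2β; this is exactly the range in which the integral defining the inverted moment converges (outside it the moment is infinite). *)

theory Defs
  imports "HOL-Probability.Probability" "HOL-Complex_Analysis.Complex_Analysis"
begin

text \<open>The function written \<open>\<omega>\<^sub>1\<close> with upper indices \<open>(-2\<alpha>, \<beta>)\<close>; it is used for \<open>0 < x < 1\<close>.\<close>

definition omega1 :: "real \<Rightarrow> real \<Rightarrow> real \<Rightarrow> real" where
  "omega1 \<alpha> \<beta> x = ((1 + x powr \<beta>) / (1 - x powr \<beta>)) powr (- \<alpha>)"

definition rtuomg_density :: "real \<Rightarrow> real \<Rightarrow> real \<Rightarrow> real \<Rightarrow> real" where
  "rtuomg_density \<alpha> \<beta> p x =
     (if 0 < x \<and> x < 1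
      then (2 * \<alpha> * \<beta> * x powr (\<beta> - 1) / (1 - x powr (2 * \<beta>))) * omega1 \<alpha> \<beta> x
             * (1 - p - p * ln (omega1 \<alpha> \<beta> x))
      else 0)"

definition inverted_moment :: "(real \<Rightarrow> real) \<Rightarrow> real \<Rightarrow> real" where
  "inverted_moment f r = (LBINT x:{0<..<1}. x powr (- r) * f x)"

text \<open>
  The principal branch of the Gauss hypergeometric function: the holomorphic function on the
  plane slit along \<open>[1, \<infinity>)\<close> that is given by the hypergeometric series on the unit disc. It exists
  unless \<open>c\<close> is a non-positive integer, and it is unique because the slit plane is connected. The
  value is unspecified for such \<open>c\<close>, and on the slit. A continuation is needed at \<open>z = -1\<close>: for
  \<open>c = a + b - 1\<close> the terms of the series there do not in general tend to \<open>0\<close>.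
\<close>

definition hyp2F1 :: "complex \<Rightarrow> complex \<Rightarrow> complex \<Rightarrow> complex \<Rightarrow> complex" where
  "hyp2F1 a b c =
     (SOME F. F holomorphic_on (- (complex_of_real ` {1..})) \<and>
        (\<forall>z\<in>ball 0 1.
           (\<lambda>i. pochhammer a i * pochhammer b i / pochhammer c i * (z ^ i / fact i)) sums F z))"

end

theory Submission
  imports Defs
begin

text \<open>
  Put \<open>s = r / \<beta>\<close>. The substitution \<open>t = x powr \<beta>\<close> turns the inverted moment into \<open>2 * \<alpha>\<close> times
  the integral over \<open>0 < t < 1\<close> of
  \<open>t powr (- s) * (1 - t) powr (\<alpha> - 1) * (1 + t) powr (- \<alpha> - 1) *
     (1 - p + p * \<alpha> * ln ((1 + t) / (1 - t)))\<close>.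
  The summand with \<open>1 - p\<close> is Euler's integral for \<open>\<^sub>2F\<^sub>1\<close> at \<open>-1\<close>. In the other one the
  expansion \<open>ln ((1 + t) / (1 - t)) = 2 * (\<Sum>k. t ^ (2 * k + 1) / (2 * k + 1))\<close> gives, term by
  term, Euler integrals whose first parameter is shifted by odd integers.

  Two points need work. The terms of the expansion are nonnegative, so the integrable limit
  dominates the partial sums; integrability of the limit holds for all \<open>s < 2\<close>, since the
  logarithm vanishes to first order at \<open>0\<close> and is smaller at \<open>1\<close> than any negative
  power of \<open>1 - t\<close> (\<open>set_integrable_Beta_weight_ln\<close>). For \<open>1 \<le> s < 2\<close> only \<open>p = 1\<close> is admitted, and the
  summand with \<open>1 - p\<close> vanishes. And Euler's formula is needed at
  \<open>z = -1\<close>, where the hypergeometric series need not converge: the integral is holomorphic in \<open>z\<close>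
  on the whole slit plane (\<open>Euler_integral_holomorphic\<close>), it is given by the hypergeometric series
  on the unit disc (\<open>Euler_integral_series\<close>), and these two properties determine \<open>hyp2F1\<close>
  (\<open>hyp2F1_eqI\<close>).
\<close>

section \<open>Holomorphic dependence of integrals on a parameter\<close>

text \<open>
  Differentiation under the integral sign. A local bound \<open>g\<close> on the integrands alone suffices:
  Cauchy's inequality on discs of radius \<open>d\<close> turns it into the bound \<open>g / d\<close> on the
  \<open>z\<close>-derivatives, hence on the difference quotients, and dominated convergence applies.
\<close>

lemma holomorphic_on_lebesgue_integral:
  fixes f :: "complex \<Rightarrow> 'a \<Rightarrow> complex"
  assumes S: "open S"
    and meas: "\<And>z. z \<in> S \<Longrightarrow> f z \<in> borel_measurable M"
    and hol: "\<And>t. t \<in> space M \<Longrightarrow> (\<lambda>z. f z t) holomorphic_on S"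
    and dom: "\<And>z\<^sub>0. z\<^sub>0 \<in> S \<Longrightarrow> \<exists>e>0. \<exists>g. integrable M g \<and>
                (\<forall>z\<in>ball z\<^sub>0 e \<inter> S. \<forall>t\<in>space M. norm (f z t) \<le> g t)"
  shows "(\<lambda>z. \<integral>t. f z t \<partial>M) holomorphic_on S"
  unfolding holomorphic_on_open[OF S]
proof
  fix z0 assume z0: "z0 \<in> S"
  obtain e and g :: "'a \<Rightarrow> real" where e: "e > 0" and g: "integrable M g"
    and bound: "\<And>z t. z \<in> ball z0 e \<inter> S \<Longrightarrow> t \<in> space M \<Longrightarrow> norm (f z t) \<le> g t"
    using dom[OF z0] by blast
  obtain e' where e': "e' > 0" "ball z0 e' \<subseteq> ball z0 e \<inter> S"
    using open_contains_ball[of "ball z0 e \<inter> S"] S z0 e by (metis Int_iff centre_in_ball open_Int open_ball)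
  \<comment> \<open>A third of the radius, so that discs of radius \<open>d\<close> about points of \<open>ball z0 d\<close> stay inside
      the region where the bound holds.\<close>
  define d where "d = e' / 3"
  have d: "d > 0" using e' by (simp add: d_def)
  have sub: "cball w d \<subseteq> ball z0 e \<inter> S" if "w \<in> ball z0 d" for w
  proof -
    have "cball w d \<subseteq> ball z0 e'"
    proof
      fix x assume "x \<in> cball w d"
      hence "dist z0 x < d + d" using that dist_triangle[of z0 x w] by auto
      thus "x \<in> ball z0 e'" using d by (simp add: d_def)
    qed
    thus ?thesis using e' by blast
  qed
  have bd_sub: "ball z0 d \<subseteq> ball z0 e \<inter> S"
    using sub[of z0] d ball_subset_cball by (meson centre_in_ball order_trans)
  have integ: "integrable M (f z)" if "z \<in> ball z0 d" for z
    by (rule Bochner_Integration.integrable_bound[OF g])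
       (use that bd_sub meas bound in \<open>force intro!: AE_I2\<close>)+
  have der_bound: "norm (deriv (\<lambda>z. f z t) w) \<le> g t / d" if "w \<in> ball z0 d" "t \<in> space M" for w t
  proof -
    have "norm ((deriv ^^ 1) (\<lambda>z. f z t) w) \<le> fact 1 * g t / d ^ 1"
    proof (rule Cauchy_inequality)
      show "(\<lambda>z. f z t) holomorphic_on ball w d"
        using hol[OF that(2)] sub[OF that(1)] by (meson Int_subset_iff ball_subset_cball holomorphic_on_subset order_trans)
      show "continuous_on (cball w d) (\<lambda>z. f z t)"
        using hol[OF that(2)] sub[OF that(1)]
        by (meson Int_subset_iff holomorphic_on_imp_continuous_on holomorphic_on_subset)
      show "norm (f x t) \<le> g t" if "norm (w - x) = d" for x
        using sub[OF \<open>w \<in> ball z0 d\<close>] that bound[OF _ \<open>t \<in> space M\<close>] by (auto simp: dist_norm subset_iff)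
    qed (use d in auto)
    thus ?thesis by simp
  qed
  have der: "((\<lambda>z. f z t) has_field_derivative deriv (\<lambda>z. f z t) w) (at w)"
    if "w \<in> ball z0 d" "t \<in> space M" for w t
    using hol[OF that(2)] S bd_sub that(1) by (intro holomorphic_derivI[of _ S]) auto
  have lip: "norm (f z t - f z0 t) \<le> g t / d * norm (z - z0)"
    if "z \<in> ball z0 d" "t \<in> space M" for z t
    by (rule field_differentiable_bound[where S = "ball z0 d" and f' = "deriv (\<lambda>z. f z t)"])
       (use der_bound der that d in \<open>auto intro: has_field_derivative_at_within\<close>)
  have "((\<lambda>z. \<integral>t. f z t \<partial>M) has_field_derivative (\<integral>t. deriv (\<lambda>z. f z t) z0 \<partial>M)) (at z0 within ball z0 d)"
    unfolding has_field_derivative_iff tendsto_at_iff_sequentially o_def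
  proof (intro allI impI)
    fix X assume X: "\<forall>n::nat. X n \<in> ball z0 d - {z0}" and lim: "X \<longlonglongrightarrow> z0"
    have lim': "(\<lambda>n. (f (X n) t - f z0 t) / (X n - z0)) \<longlonglongrightarrow> deriv (\<lambda>z. f z t) z0"
      if "t \<in> space M" for t
      using has_field_derivative_at_within[OF der[OF _ that], of z0 "ball z0 d"] d X lim
      unfolding has_field_derivative_iff tendsto_at_iff_sequentially o_def by auto
    have meas': "(\<lambda>t. (f (X n) t - f z0 t) / (X n - z0)) \<in> borel_measurable M" for n
    proof -
      have [measurable]: "f (X n) \<in> borel_measurable M" "f z0 \<in> borel_measurable M"
        using X z0 bd_sub meas by blast+
      show ?thesis by measurable
    qed
    have "(\<lambda>n. \<integral>t. (f (X n) t - f z0 t) / (X n - z0) \<partial>M)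
             \<longlonglongrightarrow> (\<integral>t. deriv (\<lambda>z. f z t) z0 \<partial>M)"
    proof (rule integral_dominated_convergence)
      show "(\<lambda>t. deriv (\<lambda>z. f z t) z0) \<in> borel_measurable M"
        by (rule borel_measurable_LIMSEQ_metric[OF meas' lim'])
      show "integrable M (\<lambda>t. g t / d)" using g by simp
      show "AE t in M. norm ((f (X n) t - f z0 t) / (X n - z0)) \<le> g t / d" for n
      proof (rule AE_I2)
        fix t assume t: "t \<in> space M"
        have "X n \<in> ball z0 d" "X n - z0 \<noteq> 0" using X by auto
        thus "norm ((f (X n) t - f z0 t) / (X n - z0)) \<le> g t / d"
          using lip[OF _ t, of "X n"] by (simp add: norm_divide pos_divide_le_eq)
      qed
    qed (use meas' lim' in auto)
    moreover have "(\<integral>t. (f (X n) t - f z0 t) / (X n - z0) \<partial>M) =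
        ((\<integral>t. f (X n) t \<partial>M) - (\<integral>t. f z0 t \<partial>M)) / (X n - z0)" for n
      using integ[of "X n"] integ[of z0] X d by simp
    ultimately show "(\<lambda>n. ((\<integral>t. f (X n) t \<partial>M) - (\<integral>t. f z0 t \<partial>M)) / (X n - z0))
             \<longlonglongrightarrow> (\<integral>t. deriv (\<lambda>z. f z t) z0 \<partial>M)" by (simp only:)
  qed
  thus "\<exists>f'. ((\<lambda>z. \<integral>t. f z t \<partial>M) has_field_derivative f') (at z0)"
    using d by (simp only: at_within_open[OF _ open_ball] centre_in_ball) blast
qed

section \<open>Facts on the beta function\<close>

lemma Beta_pos_real: "a > 0 \<Longrightarrow> b > 0 \<Longrightarrow> Beta a b > (0 :: real)"
  by (simp add: Beta_def Gamma_real_pos)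

lemma Beta_add_nat:
  fixes a b :: real
  assumes "a > 0" "b > 0"
  shows "Beta (a + real n) b = Beta a b * pochhammer a n / pochhammer (a + b) n"
proof -
  have "a \<notin> \<int>\<^sub>\<le>\<^sub>0" "a + b \<notin> \<int>\<^sub>\<le>\<^sub>0" using assms by (auto elim!: nonpos_Ints_cases)
  moreover have "Gamma a > 0" "Gamma (a + b) > 0" "Gamma (a + b + real n) > 0"
    using assms by (auto intro: Gamma_real_pos)
  ultimately show ?thesis
    by (simp add: Beta_def pochhammer_Gamma field_simps)
qed

lemma set_integral_Beta:
  fixes a b :: real
  assumes "a > 0" "b > 0"
  shows "set_integrable lborel {0<..<1} (\<lambda>t. t powr (a - 1) * (1 - t) powr (b - 1))"
    and "(LBINT t:{0<..<1}. t powr (a - 1) * (1 - t) powr (b - 1)) = Beta a b"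
proof -
  show int: "set_integrable lborel {0<..<1} (\<lambda>t. t powr (a - 1) * (1 - t) powr (b - 1))"
    by (rule set_integrable_subset[OF integrable_Beta[OF assms]]) auto
  have "((\<lambda>t. t powr (a - 1) * (1 - t) powr (b - 1)) has_integral Beta a b) {0<..<1}"
    using has_integral_Beta_real[OF assms] by (simp add: has_integral_Icc_iff_Ioo)
  thus "(LBINT t:{0<..<1}. t powr (a - 1) * (1 - t) powr (b - 1)) = Beta a b"
    using set_borel_integral_eq_integral(2)[OF int] by (simp add: integral_unique)
qed

section \<open>Uniqueness of the analytic continuation\<close>

lemma open_slit_plane: "open (- (complex_of_real ` {1..}))"
  by (intro open_Compl closed_injective_linear_image linear_of_real) (auto simp: inj_def)

text \<open>
  The slit plane is open and, being starlike, connected; so a holomorphic function on it is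
  determined by its values on the unit disc. The function \<open>F\<close> also witnesses that the choice in
  the definition of \<open>hyp2F1\<close> is from a nonempty set.
\<close>

lemma hyp2F1_eqI:
  assumes F: "F holomorphic_on - (complex_of_real ` {1..})"
    and ser: "\<And>z. norm z < 1 \<Longrightarrow>
      (\<lambda>i. pochhammer a i * pochhammer b i / pochhammer c i * (z ^ i / fact i)) sums F z"
    and z: "z \<notin> complex_of_real ` {1..}"
  shows "hyp2F1 a b c z = F z"
proof -
  let ?S = "- (complex_of_real ` {1..})"
  let ?P = "\<lambda>F. F holomorphic_on ?S \<and> (\<forall>z\<in>ball 0 1.
       (\<lambda>i. pochhammer a i * pochhammer b i / pochhammer c i * (z ^ i / fact i)) sums F z)"
  have "?P F" using F ser by simp
  hence *: "?P (hyp2F1 a b c)" unfolding hyp2F1_def by (rule someI[of ?P])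
  show ?thesis
  proof (rule analytic_continuation_open[of "ball 0 1" ?S "hyp2F1 a b c" F])
    show "open ?S" by (rule open_slit_plane)
    show "connected ?S" by (intro starlike_imp_connected starlike_slotted_complex_plane_right)
    show "ball 0 1 \<subseteq> ?S" by auto
    show "hyp2F1 a b c w = F w" if "w \<in> ball 0 1" for w
      using * ser[of w] that by (auto intro: sums_unique2)
  qed (use * F z in auto)
qed

section \<open>Euler's integral\<close>

text \<open>
  If \<open>1 - z * t\<close> were a real number \<open>x \<le> 0\<close>, then \<open>z = (1 - x) / t \<ge> 1\<close> would lie on the slit.
  Thus the base of the power in Euler's integrand stays in the domain where the principal
  branch is holomorphic.
\<close>

lemma one_minus_mult_notin_nonpos_Reals:
  assumes "z \<notin> complex_of_real ` {1..}" "0 \<le> t" "t \<le> 1"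
  shows "1 - z * of_real t \<notin> \<real>\<^sub>\<le>\<^sub>0"
proof
  assume "1 - z * of_real t \<in> \<real>\<^sub>\<le>\<^sub>0"
  then obtain x where x: "x \<le> 0" "1 - z * of_real t = of_real x"
    by (auto elim!: nonpos_Reals_cases)
  hence zt: "z * of_real t = of_real (1 - x)" by (simp add: algebra_simps)
  hence "t \<noteq> 0" using x by auto
  hence "z = of_real ((1 - x) / t)" using zt by (simp add: field_simps)
  moreover have "(1 - x) / t \<ge> 1" using \<open>t \<noteq> 0\<close> assms x by (simp add: field_simps)
  ultimately show False using assms(1) by (metis atLeast_iff imageI)
qed

lemma continuous_on_Euler_kernel:
  fixes \<nu> :: complex
  shows "continuous_on ((- (complex_of_real ` {1..})) \<times> {0..1})
           (\<lambda>p. (1 - fst p * of_real (snd p)) powr (- \<nu>))"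
proof (rule continuous_on_compose2[where g = "\<lambda>w. w powr (- \<nu>)"
          and f = "\<lambda>p. 1 - fst p * of_real (snd p)"])
  show "continuous_on (- \<real>\<^sub>\<le>\<^sub>0) (\<lambda>w. w powr (- \<nu>))"
    by (intro holomorphic_on_imp_continuous_on holomorphic_intros) auto
  show "continuous_on ((- (complex_of_real ` {1..})) \<times> {0..1}) (\<lambda>p. 1 - fst p * of_real (snd p))"
    by (intro continuous_intros)
  show "(\<lambda>p. 1 - fst p * of_real (snd p)) ` ((- (complex_of_real ` {1..})) \<times> {0..1}) \<subseteq> - \<real>\<^sub>\<le>\<^sub>0"
    using one_minus_mult_notin_nonpos_Reals by auto
qed

text \<open>
  Near a point of the slit plane the kernel \<open>(1 - z * t) powr (- \<nu>)\<close> is bounded by a constant,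
  uniformly in \<open>t\<close>, because it is continuous on a compact product; a multiple of the integrable
  beta weight is therefore a local bound.
\<close>

lemma Euler_integral_holomorphic:
  fixes a b :: real and \<nu> :: complex
  assumes "a > 0" "b > 0"
  shows "(\<lambda>z. LINT t:{0<..<1}|lborel. of_real (t powr (a - 1) * (1 - t) powr (b - 1)) *
            (1 - z * of_real t) powr (- \<nu>)) holomorphic_on - (complex_of_real ` {1..})"
  unfolding set_lebesgue_integral_def
proof (rule holomorphic_on_lebesgue_integral)
  let ?S = "- (complex_of_real ` {1..})"
  show open_S: "open ?S" by (rule open_slit_plane)
  let ?w = "\<lambda>t::real. t powr (a - 1) * (1 - t) powr (b - 1)"
  let ?f = "\<lambda>(z::complex) t::real. indicat_real {0<..<1} t *\<^sub>R
              (of_real (?w t) * (1 - z * of_real t) powr (- \<nu>))"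
  show "?f z \<in> borel_measurable lborel" if z: "z \<in> ?S" for z
  proof -
    have "continuous_on {0<..<1} (\<lambda>t. (1 - z * of_real t) powr (- \<nu>))"
      using z by (intro continuous_on_compose2[OF continuous_on_Euler_kernel,
                    where f = "\<lambda>t. (z, t)", unfolded fst_conv snd_conv] continuous_intros) auto
    moreover have "continuous_on {0<..<1} (\<lambda>t. complex_of_real (?w t))"
      by (intro continuous_intros) auto
    ultimately have "continuous_on {0<..<1} (\<lambda>t. of_real (?w t) * (1 - z * of_real t) powr (- \<nu>))"
      by (intro continuous_on_mult)
    thus ?thesis
      using borel_measurable_continuous_on_indicator[of "{0<..<1}"] by simp
  qed
  show "(\<lambda>z. ?f z t) holomorphic_on ?S" for t
  proof (cases "t \<in> {0<..<1}")
    case True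
    thus ?thesis using one_minus_mult_notin_nonpos_Reals[of _ t]
      by (auto simp: scaleR_conv_of_real intro!: holomorphic_intros)
  qed auto
  fix z0 assume "z0 \<in> ?S"
  then obtain e where e: "e > 0" "cball z0 e \<subseteq> ?S"
    using open_S open_contains_cball by blast
  let ?K = "cball z0 e \<times> {0..1::real}"
  have "continuous_on ?K (\<lambda>p. (1 - fst p * of_real (snd p)) powr (- \<nu>))"
    by (rule continuous_on_subset[OF continuous_on_Euler_kernel]) (use e in auto)
  hence "bounded ((\<lambda>p. (1 - fst p * of_real (snd p)) powr (- \<nu>)) ` ?K)"
    by (intro compact_imp_bounded compact_continuous_image compact_Times) auto
  then obtain C where C: "\<And>p. p \<in> ?K \<Longrightarrow> norm ((1 - fst p * of_real (snd p)) powr (- \<nu>)) \<le> C"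
    unfolding bounded_iff by blast
  show "\<exists>e>0. \<exists>g. integrable lborel g \<and>
          (\<forall>z\<in>ball z0 e \<inter> ?S. \<forall>t\<in>space lborel. norm (?f z t) \<le> g t)"
  proof (intro exI conjI ballI)
    show "e > 0" by fact
    show "integrable lborel (\<lambda>t. C * (indicat_real {0<..<1} t *\<^sub>R ?w t))"
      using set_integral_Beta(1)[OF assms] unfolding set_integrable_def
      by (rule integrable_mult_right)
    fix z t assume z: "z \<in> ball z0 e \<inter> ?S"
    show "norm (?f z t) \<le> C * (indicat_real {0<..<1} t *\<^sub>R ?w t)"
    proof (cases "t \<in> {0<..<1}")
      case True
      hence "norm ((1 - z * of_real t) powr (- \<nu>)) \<le> C" using C[of "(z, t)"] z by auto
      hence "?w t * norm ((1 - z * of_real t) powr (- \<nu>)) \<le> ?w t * C"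
        by (intro mult_left_mono) auto
      thus ?thesis using True by (simp add: norm_mult mult_ac)
    qed auto
  qed
qed

lemma binomial_series_pochhammer:
  fixes w \<nu> :: complex
  assumes "norm w < 1"
  shows "(\<lambda>i. pochhammer \<nu> i / fact i * w ^ i) sums (1 - w) powr (- \<nu>)"
proof -
  have "(- \<nu> gchoose i) * (- w) ^ i = pochhammer \<nu> i / fact i * w ^ i" for i
  proof -
    have "(- 1) ^ i * (- w) ^ i = w ^ i" by (simp flip: power_mult_distrib)
    thus ?thesis by (simp add: gbinomial_pochhammer)
  qed
  moreover have "(\<lambda>i. (- \<nu> gchoose i) * (- w) ^ i) sums (1 + - w) powr (- \<nu>)"
    by (rule gen_binomial_complex) (use assms in simp)
  ultimately show ?thesis by (simp only: add_uminus_conv_diff)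
qed

lemma abs_summable_binomial_series:
  fixes w \<nu> :: complex
  assumes "norm w < 1"
  shows "summable (\<lambda>i. norm (pochhammer \<nu> i / fact i * w ^ i))"
proof (rule powser_insidea)
  \<comment> \<open>Convergence at a point of larger modulus, still below \<open>1\<close>, implies absolute convergence
      at \<open>w\<close>.\<close>
  define r where "r = (1 + norm w) / 2"
  have r: "norm w < norm (complex_of_real r)" "norm (complex_of_real r) < 1"
    unfolding norm_of_real using assms by (simp_all add: r_def)
  show "norm w < norm (complex_of_real r)" by fact
  show "summable (\<lambda>i. pochhammer \<nu> i / fact i * complex_of_real r ^ i)"
    by (rule sums_summable[OF binomial_series_pochhammer[OF r(2)]])
qed

text \<open>
  The kernel is expanded in powers of \<open>z * t\<close>, and the power \<open>t ^ i\<close> shifts the first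
  parameter of the beta weight by \<open>i\<close>. Since \<open>Beta (a + i) b \<le> Beta a b\<close>, the norms of the terms
  have integrals dominated by an absolutely convergent binomial series, which allows integration
  term by term.
\<close>

lemma Euler_integral_series:
  fixes a b :: real and \<nu> :: complex
  assumes a: "a > 0" and b: "b > 0" and z: "norm z < 1"
  shows "(\<lambda>i. of_real (Beta a b) * (pochhammer \<nu> i * pochhammer (of_real a) i /
            pochhammer (of_real (a + b)) i * (z ^ i / fact i))) sums
         (LINT t:{0<..<1}|lborel. of_real (t powr (a - 1) * (1 - t) powr (b - 1)) *
            (1 - z * of_real t) powr (- \<nu>))"
proof -
  let ?w = "\<lambda>t::real. t powr (a - 1) * (1 - t) powr (b - 1)"
  let ?wn = "\<lambda>(i::nat) t::real. t powr (a + real i - 1) * (1 - t) powr (b - 1)"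
  let ?c = "\<lambda>i. pochhammer \<nu> i / fact i * z ^ i"
  let ?f = "\<lambda>i t. indicat_real {0<..<1} t *\<^sub>R (of_real (?wn i t) * ?c i)"
  have binom: "(\<lambda>i. ?f i t) sums (indicat_real {0<..<1} t *\<^sub>R
                 (of_real (?w t) * (1 - z * of_real t) powr (- \<nu>)))"
    and binom': "summable (\<lambda>i. norm (?f i t))" for t
  proof -
    have "(\<lambda>i. ?f i t) sums (indicat_real {0<..<1} t *\<^sub>R
                 (of_real (?w t) * (1 - z * of_real t) powr (- \<nu>))) \<and> summable (\<lambda>i. norm (?f i t))"
    proof (cases "t \<in> {0<..<1}")
      case True
      have nz: "norm (z * of_real t) < 1"
        using z True mult_mono[of "norm z" "norm z" t 1] by (simp add: norm_mult)
      have wn: "of_real (?wn i t) * ?c i =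
                  of_real (?w t) * (pochhammer \<nu> i / fact i * (z * of_real t) ^ i)" for i
        using True by (simp add: powr_add powr_diff powr_realpow power_mult_distrib)
      have "summable (\<lambda>i. norm (pochhammer \<nu> i / fact i * (z * of_real t) ^ i))"
        by (rule abs_summable_binomial_series[OF nz])
      hence "summable (\<lambda>i. norm (of_real (?w t) :: complex) *
                norm (pochhammer \<nu> i / fact i * (z * of_real t) ^ i))"
        by (rule summable_mult)
      moreover have "(\<lambda>i. of_real (?w t) * (pochhammer \<nu> i / fact i * (z * of_real t) ^ i)) sums
                        (of_real (?w t) * (1 - z * of_real t) powr (- \<nu>))"
        by (intro sums_mult binomial_series_pochhammer nz)
      moreover have "?f i t = of_real (?w t) * (pochhammer \<nu> i / fact i * (z * of_real t) ^ i)" for i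
        using True by (simp only: wn) simp
      ultimately show ?thesis using True by (simp only: norm_mult) simp
    qed auto
    thus "(\<lambda>i. ?f i t) sums (indicat_real {0<..<1} t *\<^sub>R
                 (of_real (?w t) * (1 - z * of_real t) powr (- \<nu>)))"
      "summable (\<lambda>i. norm (?f i t))" by blast+
  qed
  have intw: "integrable lborel (\<lambda>t. indicat_real {0<..<1} t *\<^sub>R ?wn i t)"
    and Betaw: "(LINT t|lborel. indicat_real {0<..<1} t *\<^sub>R ?wn i t) = Beta (a + real i) b" for i
    using set_integral_Beta[of "a + real i" b] a b
    by (simp_all add: set_integrable_def set_lebesgue_integral_def)
  have f_eq: "?f i t = of_real (indicat_real {0<..<1} t *\<^sub>R ?wn i t) * ?c i" for i t
    by (simp add: scaleR_conv_of_real)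
  have norm_f: "norm (?f i t) = (indicat_real {0<..<1} t *\<^sub>R ?wn i t) * norm (?c i)" for i t
    by (simp only: f_eq norm_mult norm_of_real) (simp add: abs_mult)
  have intf: "integrable lborel (?f i)" for i
    unfolding f_eq by (intro integrable_mult_left integrable_of_real intw)
  have "(\<lambda>i. integral\<^sup>L lborel (?f i)) sums (LINT t|lborel. (\<Sum>i. ?f i t))"
  proof (rule sums_integral[OF intf])
    show "AE t in lborel. summable (\<lambda>i. norm (?f i t))" by (rule AE_I2) (rule binom')
    have "(\<integral>t. norm (?f i t) \<partial>lborel) = Beta (a + real i) b * norm (?c i)" for i
      unfolding norm_f by (subst integral_mult_left_zero) (simp only: Betaw)
    moreover have "summable (\<lambda>i. Beta (a + real i) b * norm (?c i))"
    proof (rule summable_comparison_test)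
      have "norm (Beta (a + real i) b * norm (?c i)) \<le> Beta a b * norm (?c i)" for i
      proof -
        have "norm (Beta (a + real i) b) \<le> Beta a b"
          using Beta_real_mono[of a "a + real i" b b] Beta_pos_real[of "a + real i" b] a b by simp
        from mult_right_mono[OF this norm_ge_zero[of "?c i"]]
        show ?thesis by (simp only: norm_mult[of "Beta (a + real i) b"] real_norm_def abs_norm_cancel abs_mult)
      qed
      thus "\<exists>N. \<forall>i\<ge>N. norm (Beta (a + real i) b * norm (?c i)) \<le> Beta a b * norm (?c i)"
        by blast
      show "summable (\<lambda>i. Beta a b * norm (?c i))"
        by (intro summable_mult abs_summable_binomial_series z)
    qed
    ultimately show "summable (\<lambda>i. \<integral>t. norm (?f i t) \<partial>lborel)" by (simp only:)
  qed
  moreover have "(\<Sum>i. ?f i t) = indicat_real {0<..<1} t *\<^sub>R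
                 (of_real (?w t) * (1 - z * of_real t) powr (- \<nu>))" for t
    using binom by (rule sums_unique[symmetric])
  moreover have "integral\<^sup>L lborel (?f i) =
      of_real (Beta a b) * (pochhammer \<nu> i * pochhammer (of_real a) i /
            pochhammer (of_real (a + b)) i * (z ^ i / fact i))" for i
  proof -
    have "integral\<^sup>L lborel (?f i) = of_real (Beta (a + real i) b) * ?c i"
      unfolding f_eq by (subst integral_mult_left_zero) (simp only: integral_complex_of_real Betaw)
    thus ?thesis
      by (simp only: Beta_add_nat[OF a b] pochhammer_of_real of_real_mult of_real_divide)
         (simp add: mult_ac)
  qed
  ultimately show ?thesis unfolding set_lebesgue_integral_def by (simp only:)
qed

theorem Euler_integral_hyp2F1:
  fixes a b :: real and \<nu> z :: complex
  assumes a: "a > 0" and b: "b > 0" and z: "z \<notin> complex_of_real ` {1..}"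
  shows "of_real (Beta a b) * hyp2F1 \<nu> (of_real a) (of_real (a + b)) z =
         (LINT t:{0<..<1}|lborel. of_real (t powr (a - 1) * (1 - t) powr (b - 1)) *
            (1 - z * of_real t) powr (- \<nu>))" (is "_ = ?F z")
proof -
  have B: "complex_of_real (Beta a b) \<noteq> 0" using Beta_pos_real[OF a b] by simp
  have "hyp2F1 \<nu> (of_real a) (of_real (a + b)) z = ?F z / of_real (Beta a b)"
  proof (rule hyp2F1_eqI[OF _ _ z])
    show "(\<lambda>z. ?F z / of_real (Beta a b)) holomorphic_on - (complex_of_real ` {1..})"
      by (intro holomorphic_on_divide Euler_integral_holomorphic a b holomorphic_on_const B)
    fix z :: complex assume "norm z < 1"
    from sums_divide[OF Euler_integral_series[OF a b this], of \<nu> "of_real (Beta a b)"]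
    show "(\<lambda>i. pochhammer \<nu> i * pochhammer (of_real a) i / pochhammer (of_real (a + b)) i *
            (z ^ i / fact i)) sums (?F z / of_real (Beta a b))"
      using B by (simp add: mult_ac)
  qed
  thus ?thesis using B by simp
qed

corollary Euler_integral_hyp2F1_minus_one:
  fixes a b c :: real
  assumes "a > 0" "b > 0"
  shows "of_real (Beta a b) * hyp2F1 (of_real c) (of_real a) (of_real (a + b)) (- 1) =
         complex_of_real (LBINT t:{0<..<1}. t powr (a - 1) * (1 - t) powr (b - 1) * (1 + t) powr (- c))"
proof -
  have "- 1 \<notin> complex_of_real ` {1..}"
  proof
    assume "- 1 \<in> complex_of_real ` {1..}"
    then obtain x :: real where "x \<ge> 1" "- 1 = complex_of_real x" by auto
    hence "Re (- 1) = x" by (metis Re_complex_of_real)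
    thus False using \<open>x \<ge> 1\<close> by simp
  qed
  note Euler_integral_hyp2F1[OF assms this, of "of_real c"]
  also have "(LINT t:{0<..<1}|lborel. of_real (t powr (a - 1) * (1 - t) powr (b - 1)) *
            (1 - (- 1) * complex_of_real t) powr (- of_real c)) =
      (LINT t:{0<..<1}|lborel. complex_of_real
         (t powr (a - 1) * (1 - t) powr (b - 1) * (1 + t) powr (- c)))"
  proof (rule set_lebesgue_integral_cong)
    show "\<forall>t. t \<in> {0<..<1} \<longrightarrow> of_real (t powr (a - 1) * (1 - t) powr (b - 1)) *
            (1 - (- 1) * complex_of_real t) powr (- of_real c) =
         complex_of_real (t powr (a - 1) * (1 - t) powr (b - 1) * (1 + t) powr (- c))"
    proof (intro allI impI)
      fix t :: real assume "t \<in> {0<..<1}"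
      thus "of_real (t powr (a - 1) * (1 - t) powr (b - 1)) *
            (1 - (- 1) * complex_of_real t) powr (- of_real c) =
         complex_of_real (t powr (a - 1) * (1 - t) powr (b - 1) * (1 + t) powr (- c))"
        using powr_of_real[of "1 + t" "- c"] by simp
    qed
  qed simp
  finally show ?thesis by (simp only: set_integral_complex_of_real of_real_minus of_real_1)
qed

section \<open>Integrals with the logarithm of (1 + t) / (1 - t)\<close>

text \<open>
  The logarithmic series for \<open>1 + t\<close> and \<open>1 - t\<close> are subtracted; the even powers cancel.
\<close>

lemma ln_one_plus_over_one_minus_sums:
  fixes t :: real
  assumes "0 \<le> t" "t < 1"
  shows "(\<lambda>k. 2 * t ^ (2 * k + 1) / real (2 * k + 1)) sums ln ((1 + t) / (1 - t))"
proof -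
  let ?f = "\<lambda>n. - ((- t) ^ n) / real n + t ^ n / real n"
  have "?f sums (ln (1 + t) - ln (1 - t))"
    using sums_diff[OF ln_series'[of t] ln_series'[of "- t"]] assms by simp
  moreover have "ln (1 + t) - ln (1 - t) = ln ((1 + t) / (1 - t))"
    using assms by (simp add: ln_div)
  moreover have "(\<lambda>k. ?f (2 * k + 1)) sums S \<longleftrightarrow> ?f sums S" for S
  proof (rule sums_mono_reindex)
    show "strict_mono (\<lambda>k::nat. 2 * k + 1)" by (simp add: strict_mono_def)
    show "?f n = 0" if "n \<notin> range (\<lambda>k. 2 * k + 1)" for n
    proof -
      have "even n" using that by (metis oddE rangeI)
      thus ?thesis by simp
    qed
  qed
  ultimately show ?thesis by simp
qed

text \<open>
  The factor \<open>t\<close> records the zero of the logarithm at \<open>0\<close>, and the negative power of \<open>1 - t\<close>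
  absorbs its singularity at \<open>1\<close>. With \<open>y = (1 - t) powr (- \<delta>)\<close> the inequality
  \<open>ln y \<le> y - 1\<close> gives \<open>- \<delta> * ln (1 - t) \<le> y - 1\<close>, and \<open>y - 1 \<le> t * y\<close> because
  \<open>1 - t \<le> (1 - t) powr \<delta>\<close> for \<open>\<delta> \<le> 1\<close>.
\<close>

lemma ln_one_plus_over_one_minus_le:
  fixes t \<delta> :: real
  assumes t: "0 < t" "t < 1" and \<delta>: "0 < \<delta>" "\<delta> \<le> 1"
  shows "ln ((1 + t) / (1 - t)) \<le> (1 + 1 / \<delta>) * (t * (1 - t) powr (- \<delta>))"
proof -
  let ?y = "(1 - t) powr (- \<delta>)"
  have y1: "1 \<le> ?y" using t \<delta> powr_mono'[of "- \<delta>" 0 "1 - t"] by simp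
  have "1 - t \<le> (1 - t) powr \<delta>" using t \<delta> powr_mono'[of \<delta> 1 "1 - t"] by simp
  hence "(1 - t) * ?y \<le> (1 - t) powr \<delta> * ?y" by (intro mult_right_mono) auto
  hence "?y - 1 \<le> t * ?y" using t by (simp add: powr_minus algebra_simps)
  moreover have "- \<delta> * ln (1 - t) \<le> ?y - 1"
    using ln_le_minus_one[of ?y] t by (simp add: ln_powr)
  ultimately have "- ln (1 - t) \<le> t * ?y / \<delta>"
    using \<delta> by (simp add: field_simps)
  moreover have "ln (1 + t) \<le> t" using t by (intro ln_add_one_self_le_self) simp
  moreover have "t \<le> t * ?y" using y1 t by simp
  ultimately have "ln (1 + t) - ln (1 - t) \<le> t * ?y + t * ?y / \<delta>" by linarith
  thus ?thesis using t by (simp add: ln_div algebra_simps)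
qed

lemma set_integrable_Beta_weight:
  fixes a b c :: real
  assumes "a > 0" "b > 0" "c \<ge> 0"
  shows "set_integrable lborel {0<..<1} (\<lambda>t. t powr (a - 1) * (1 - t) powr (b - 1) * (1 + t) powr (- c))"
proof (rule set_integrable_bound[OF set_integral_Beta(1)[OF assms(1,2)]])
  have "norm (t powr (a - 1) * (1 - t) powr (b - 1) * (1 + t) powr (- c)) \<le>
          norm (t powr (a - 1) * (1 - t) powr (b - 1))" if "t \<in> {0<..<1}" for t
    using powr_mono[of "- c" 0 "1 + t"] that assms by (simp add: abs_mult mult_left_le)
  thus "AE t in lborel. t \<in> {0<..<1} \<longrightarrow>
      norm (t powr (a - 1) * (1 - t) powr (b - 1) * (1 + t) powr (- c)) \<le>
      norm (t powr (a - 1) * (1 - t) powr (b - 1))" by auto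
qed (simp add: set_borel_measurable_def)

text \<open>
  The integrand is bounded by a multiple of the weight with \<open>a + 1\<close> and \<open>b - \<delta>\<close> in place of
  \<open>a\<close> and \<open>b\<close>. The zero of the logarithm at \<open>0\<close> is what extends the range of \<open>a\<close> from
  \<open>a > 0\<close> to \<open>a > -1\<close>.
\<close>

lemma set_integrable_Beta_weight_ln:
  fixes a b c :: real
  assumes "a > -1" "b > 0" "c \<ge> 0"
  shows "set_integrable lborel {0<..<1} (\<lambda>t. t powr (a - 1) * (1 - t) powr (b - 1) *
           (1 + t) powr (- c) * ln ((1 + t) / (1 - t)))"
proof -
  \<comment> \<open>At most \<open>1\<close> for the pointwise bound, and below \<open>b\<close> so that \<open>b - \<delta>\<close> stays positive.\<close>
  define \<delta> where "\<delta> = min 1 (b / 2)"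
  have \<delta>: "0 < \<delta>" "\<delta> \<le> 1" "\<delta> < b" using assms by (auto simp: \<delta>_def)
  define C where "C = 1 + 1 / \<delta>"
  have C: "C > 0" using \<delta> by (simp add: C_def add_pos_pos)
  have "set_integrable lborel {0<..<1} (\<lambda>t. C * (t powr (a + 1 - 1) * (1 - t) powr (b - \<delta> - 1) * (1 + t) powr (- c)))"
    using set_integrable_Beta_weight[of "a + 1" "b - \<delta>" c] \<delta> assms
    by (intro set_integrable_mult_right) auto
  thus ?thesis
  proof (rule set_integrable_bound)
    show "AE t in lborel. t \<in> {0<..<1} \<longrightarrow>
       norm (t powr (a - 1) * (1 - t) powr (b - 1) * (1 + t) powr (- c) * ln ((1 + t) / (1 - t)))
       \<le> norm (C * (t powr (a + 1 - 1) * (1 - t) powr (b - \<delta> - 1) * (1 + t) powr (- c)))"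
    proof (rule AE_I2, rule impI)
      fix t :: real assume t: "t \<in> {0<..<1}"
      let ?w = "t powr (a - 1) * (1 - t) powr (b - 1) * (1 + t) powr (- c)"
      have "ln ((1 + t) / (1 - t)) \<ge> 0" using t by simp
      moreover have "ln ((1 + t) / (1 - t)) \<le> C * (t * (1 - t) powr (- \<delta>))"
        unfolding C_def using t \<delta> by (intro ln_one_plus_over_one_minus_le) auto
      ultimately have "norm (?w * ln ((1 + t) / (1 - t))) \<le> ?w * (C * (t * (1 - t) powr (- \<delta>)))"
        by (simp add: abs_mult mult_left_mono)
      also have "\<dots> = C * ((t powr (a - 1) * t) * ((1 - t) powr (b - 1) * (1 - t) powr (- \<delta>)) * (1 + t) powr (- c))"
        by (simp only: mult_ac)
      also have "t powr (a - 1) * t = t powr (a + 1 - 1)"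
        using t by (simp add: powr_diff)
      also have "(1 - t) powr (b - 1) * (1 - t) powr (- \<delta>) = (1 - t) powr (b - \<delta> - 1)"
        by (simp add: algebra_simps flip: powr_add)
      finally show "norm (?w * ln ((1 + t) / (1 - t)))
       \<le> norm (C * (t powr (a + 1 - 1) * (1 - t) powr (b - \<delta> - 1) * (1 + t) powr (- c)))"
        using C by (simp add: abs_mult)
    qed
  qed (simp add: set_borel_measurable_def)
qed

text \<open>
  The terms of the logarithmic series are nonnegative, so their partial sums are dominated by the
  limit, which is integrable by the preceding lemma.
\<close>

lemma Beta_weight_ln_sums:
  fixes a b c :: real
  assumes "a > -1" "b > 0" "c \<ge> 0"
  shows "(\<lambda>k. 1 / real (2 * k + 1) *
            (LBINT t:{0<..<1}. t powr (a + real (2 * k + 1) - 1) * (1 - t) powr (b - 1) * (1 + t) powr (- c)))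
         sums (1 / 2 * (LBINT t:{0<..<1}. t powr (a - 1) * (1 - t) powr (b - 1) *
            (1 + t) powr (- c) * ln ((1 + t) / (1 - t))))"
proof -
  define w where "w = (\<lambda>t. t powr (a - 1) * (1 - t) powr (b - 1) * (1 + t) powr (- c))"
  define h where "h = (\<lambda>k t. indicat_real {0<..<1} t * (1 / real (2 * k + 1) *
      (t powr (a + real (2 * k + 1) - 1) * (1 - t) powr (b - 1) * (1 + t) powr (- c))))"
  define H where "H = (\<lambda>t. indicat_real {0<..<1} t * (1 / 2 * (w t * ln ((1 + t) / (1 - t)))))"
  have h_nonneg: "h k t \<ge> 0" for k t by (auto simp: h_def indicator_def)
  have hH: "(\<lambda>k. h k t) sums H t" for t
  proof (cases "t \<in> {0<..<1}")
    case True
    hence "(\<lambda>k. 1 / 2 * w t * (2 * t ^ (2 * k + 1) / real (2 * k + 1))) sums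
             (1 / 2 * w t * ln ((1 + t) / (1 - t)))"
      by (intro sums_mult ln_one_plus_over_one_minus_sums) auto
    moreover have "1 / 2 * w t * (2 * t ^ (2 * k + 1) / real (2 * k + 1)) = h k t" for k
    proof -
      define n where "n = 2 * k + 1"
      have "t powr (a + real n - 1) = t powr (a - 1) * t ^ n"
        using True powr_realpow[of t n] powr_add[of t "a - 1" "real n"] by (simp add: algebra_simps)
      thus ?thesis using True unfolding h_def w_def n_def[symmetric] by simp
    qed
    ultimately show ?thesis using True by (simp add: H_def)
  qed (simp add: h_def H_def)
  have int_h: "integrable lborel (h k)" for k
    using set_integrable_Beta_weight[of "a + real (2 * k + 1)" b c] assms
    unfolding set_integrable_def h_def
    by (subst mult.left_commute) (simp add: integrable_mult_right)
  have int_H: "integrable lborel H"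
    using set_integrable_Beta_weight_ln[OF assms] unfolding set_integrable_def H_def w_def
    by (subst mult.left_commute) (simp add: integrable_mult_right)
  have "(\<lambda>n. \<integral>t. (\<Sum>k<n. h k t) \<partial>lborel) \<longlonglongrightarrow> integral\<^sup>L lborel H"
  proof (rule integral_dominated_convergence[where w = H])
    show "H \<in> borel_measurable lborel" using int_H by (rule borel_measurable_integrable)
    show "(\<lambda>t. \<Sum>k<n. h k t) \<in> borel_measurable lborel" for n
      using borel_measurable_integrable[OF int_h] by measurable
    show "AE t in lborel. (\<lambda>n. \<Sum>k<n. h k t) \<longlonglongrightarrow> H t"
      using hH by (auto simp: sums_def)
    show "AE t in lborel. norm (\<Sum>k<n. h k t) \<le> H t" for n
    proof (rule AE_I2)
      fix t
      have "(\<Sum>k<n. h k t) \<le> H t"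
        using sum_le_suminf[OF sums_summable[OF hH], of "{..<n}" t] sums_unique[OF hH, of t] h_nonneg
        by simp
      thus "norm (\<Sum>k<n. h k t) \<le> H t" by (simp add: h_nonneg sum_nonneg)
    qed
  qed (fact int_H)
  hence "(\<lambda>k. integral\<^sup>L lborel (h k)) sums integral\<^sup>L lborel H"
    unfolding sums_def by (simp add: int_h)
  moreover have "integral\<^sup>L lborel (h k) = 1 / real (2 * k + 1) *
            (LBINT t:{0<..<1}. t powr (a + real (2 * k + 1) - 1) * (1 - t) powr (b - 1) * (1 + t) powr (- c))" for k
    unfolding h_def set_lebesgue_integral_def
    by (subst mult.left_commute) (simp only: integral_mult_right_zero real_scaleR_def)
  moreover have "integral\<^sup>L lborel H = 1 / 2 * (LBINT t:{0<..<1}. w t * ln ((1 + t) / (1 - t)))"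
    unfolding H_def set_lebesgue_integral_def
    by (subst mult.left_commute) (simp only: integral_mult_right_zero real_scaleR_def)
  ultimately show ?thesis by (simp only: w_def)
qed

section \<open>Substitution in the inverted moment\<close>

text \<open>
  The last factor on the left is the derivative of the substitution; it cancels the power
  \<open>x powr (\<beta> - 1)\<close> of the density. The powers of \<open>1 - t\<close> and \<open>1 + t\<close> come from \<open>omega1\<close> and from
  the factorisation
  \<open>1 - x powr (2 * \<beta>) = (1 - t) * (1 + t)\<close>.
\<close>

lemma rtuomg_density_powr:
  assumes "\<alpha> > 0" "\<beta> > 0" and t: "0 < t" "t < 1"
  shows "(t powr (1 / \<beta>)) powr (- r) * rtuomg_density \<alpha> \<beta> p (t powr (1 / \<beta>)) *
           (1 / \<beta> * t powr (1 / \<beta> - 1)) =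
         2 * \<alpha> * (t powr (1 - r / \<beta> - 1) * (1 - t) powr (\<alpha> - 1) * (1 + t) powr (- (\<alpha> + 1)) *
           (1 - p + p * \<alpha> * ln ((1 + t) / (1 - t))))"
proof -
  let ?x = "t powr (1 / \<beta>)"
  let ?q = "1 - p + p * \<alpha> * ln ((1 + t) / (1 - t))"
  have x: "0 < ?x" "?x < 1"
    using t assms(2) powr_less_mono2[of "1 / \<beta>" t 1] by auto
  have x\<beta>: "?x powr \<beta> = t" and x2\<beta>: "?x powr (2 * \<beta>) = t * t"
    using assms t by (simp_all add: powr_powr powr_numeral power2_eq_square)
  have omega: "omega1 \<alpha> \<beta> ?x = (1 - t) powr \<alpha> * (1 + t) powr (- \<alpha>)"
    using t by (simp add: omega1_def x\<beta> powr_divide powr_minus field_simps)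
  have ln_omega: "ln (omega1 \<alpha> \<beta> ?x) = - \<alpha> * ln ((1 + t) / (1 - t))"
    using t by (simp add: omega1_def x\<beta> ln_powr)
  have jac: "?x powr (\<beta> - 1) * t powr (1 / \<beta> - 1) = 1"
  proof -
    have "1 / \<beta> * (\<beta> - 1) + (1 / \<beta> - 1) = 0" using assms by (simp add: field_simps)
    thus ?thesis using t by (simp only: powr_powr powr_add[symmetric]) simp
  qed
  have "rtuomg_density \<alpha> \<beta> p ?x =
      2 * \<alpha> * \<beta> * ?x powr (\<beta> - 1) / ((1 - t) * (1 + t)) * ((1 - t) powr \<alpha> * (1 + t) powr (- \<alpha>)) * ?q"
    using x unfolding rtuomg_density_def ln_omega x2\<beta> by (simp add: omega algebra_simps)
  also have "\<dots> = 2 * \<alpha> * \<beta> * ?x powr (\<beta> - 1) *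
      (((1 - t) powr \<alpha> / (1 - t)) * ((1 + t) powr (- \<alpha>) / (1 + t)) * ?q)"
    by simp
  also have "(1 - t) powr \<alpha> / (1 - t) = (1 - t) powr (\<alpha> - 1)"
    using t by (simp add: powr_diff)
  also have "(1 + t) powr (- \<alpha>) / (1 + t) = (1 + t) powr (- (\<alpha> + 1))"
    using t by (simp add: powr_diff)
  finally have "?x powr (- r) * rtuomg_density \<alpha> \<beta> p ?x * (1 / \<beta> * t powr (1 / \<beta> - 1)) =
      (?x powr (\<beta> - 1) * t powr (1 / \<beta> - 1)) * (\<beta> * (1 / \<beta>)) *
      (2 * \<alpha> * (t powr (1 - r / \<beta> - 1) * (1 - t) powr (\<alpha> - 1) * (1 + t) powr (- (\<alpha> + 1)) * ?q))"
    by (simp add: powr_powr mult_ac)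
  thus ?thesis using jac assms by simp
qed

lemma rtuomg_density_nonneg:
  assumes "\<alpha> > 0" "\<beta> > 0" "0 \<le> p" "p \<le> 1"
  shows "rtuomg_density \<alpha> \<beta> p x \<ge> 0"
proof (cases "0 < x \<and> x < 1")
  case True
  have x\<beta>: "0 < x powr \<beta>" "x powr \<beta> < 1" "x powr (2 * \<beta>) < 1"
    using True assms powr_less_mono2[of \<beta> x 1] powr_less_mono2[of "2 * \<beta>" x 1] by auto
  have "ln (omega1 \<alpha> \<beta> x) = - \<alpha> * ln ((1 + x powr \<beta>) / (1 - x powr \<beta>))"
    using x\<beta> by (simp add: omega1_def ln_powr)
  moreover have "ln ((1 + x powr \<beta>) / (1 - x powr \<beta>)) \<ge> 0" using x\<beta> by simp
  ultimately have "p * ln (omega1 \<alpha> \<beta> x) \<le> 0"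
    using assms by (simp add: mult_nonneg_nonneg)
  thus ?thesis using True assms x\<beta> by (simp add: rtuomg_density_def omega1_def)
qed (auto simp: rtuomg_density_def)

lemma isCont_rtuomg_density:
  assumes "\<beta> > 0" "0 < x" "x < 1"
  shows "isCont (rtuomg_density \<alpha> \<beta> p) x"
proof -
  have nz: "y \<noteq> 0" "1 - y powr (2 * \<beta>) \<noteq> 0" "1 - y powr \<beta> \<noteq> 0"
      "(1 + y powr \<beta>) / (1 - y powr \<beta>) \<noteq> 0" if "y \<in> {0<..<1}" for y
  proof -
    have "0 < y powr \<beta>" "y powr \<beta> < 1" "y powr (2 * \<beta>) < 1"
      using that assms powr_less_mono2[of \<beta> y 1] powr_less_mono2[of "2 * \<beta>" y 1] by auto
    moreover from this have "1 + y powr \<beta> \<noteq> 0" by linarith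
    ultimately show "y \<noteq> 0" "1 - y powr (2 * \<beta>) \<noteq> 0" "1 - y powr \<beta> \<noteq> 0"
      "(1 + y powr \<beta>) / (1 - y powr \<beta>) \<noteq> 0" using that by auto
  qed
  have "continuous_on {0<..<1} (\<lambda>y. (2 * \<alpha> * \<beta> * y powr (\<beta> - 1) / (1 - y powr (2 * \<beta>))) *
      omega1 \<alpha> \<beta> y * (1 - p - p * ln (omega1 \<alpha> \<beta> y)))"
    unfolding omega1_def
    by (intro continuous_intros ballI; (simp only: powr_eq_0_iff nz not_False_eq_True)?)
  hence "continuous_on {0<..<1} (rtuomg_density \<alpha> \<beta> p)"
    by (rule continuous_on_eq) (simp add: rtuomg_density_def)
  thus ?thesis by (rule continuous_on_interior) (use assms in simp)
qed

text \<open>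
  Integrability is carried from the variable \<open>t\<close> to \<open>x\<close>, that is in the direction in which it is
  known: the transformed integrand is a combination of the weights treated above.
\<close>

lemma inverted_moment_rtuomg_substitution:
  fixes \<alpha> \<beta> p r :: real
  assumes pos: "\<alpha> > 0" "\<beta> > 0" "0 \<le> p" "p \<le> 1"
  defines "I \<equiv> \<lambda>t. t powr (1 - r / \<beta> - 1) * (1 - t) powr (\<alpha> - 1) * (1 + t) powr (- (\<alpha> + 1)) *
           (1 - p + p * \<alpha> * ln ((1 + t) / (1 - t)))"
  assumes int: "set_integrable lborel {0<..<1} I"
  shows "set_integrable lborel {0<..<1} (\<lambda>x. x powr (- r) * rtuomg_density \<alpha> \<beta> p x)"
    and "inverted_moment (rtuomg_density \<alpha> \<beta> p) r = 2 * \<alpha> * (LBINT t:{0<..<1}. I t)"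
proof -
  let ?f = "\<lambda>x. x powr (- r) * rtuomg_density \<alpha> \<beta> p x"
  let ?g = "\<lambda>t::real. t powr (1 / \<beta>)" and ?g' = "\<lambda>t::real. 1 / \<beta> * t powr (1 / \<beta> - 1)"
  have eins: "einterval 0 1 = {0<..<1}" by (auto simp: einterval_def)
  have fg: "?f (?g t) * ?g' t = 2 * \<alpha> * I t" if "t \<in> {0<..<1}" for t
    using rtuomg_density_powr[of \<alpha> \<beta> t r p] pos that by (simp only: I_def greaterThanLessThan_iff)
  have g01: "0 < ?g t \<and> ?g t < 1" if "0 < t" "t < 1" for t
    using that pos powr_less_mono2[of "1 / \<beta>" t 1] by auto
  have int': "set_integrable lborel {0<..<1} (\<lambda>t. ?f (?g t) * ?g' t)"
    using set_integrable_mult_right[OF int, of "2 * \<alpha>"]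
    by (subst set_integrable_cong[OF refl refl fg]) auto
  have deriv: "(?g has_real_derivative ?g' t) (at t)" if "0 < ereal t" "ereal t < 1" for t
    using that pos by (auto intro!: derivative_eq_intros)
  have contf: "isCont ?f (?g t)" if "0 < ereal t" "ereal t < 1" for t
    using that g01[of t] pos by (intro continuous_intros isCont_rtuomg_density) auto
  have contg': "isCont ?g' t" if "0 < ereal t" "ereal t < 1" for t
    using that by (intro continuous_intros) auto
  have f_nonneg: "0 \<le> ?f (?g t)" for t
    by (intro mult_nonneg_nonneg rtuomg_density_nonneg pos) auto
  have g'_nonneg: "0 \<le> ?g' t" for t using pos by simp
  have lim0: "((ereal \<circ> ?g \<circ> real_of_ereal) \<longlongrightarrow> 0) (at_right 0)"
    unfolding zero_ereal_def ereal_tendsto_simps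
  proof -
    have "(?g \<longlongrightarrow> 0 powr (1 / \<beta>)) (at_right 0)"
      by (rule tendsto_powr'[OF tendsto_ident_at tendsto_const])
         (use pos in \<open>auto simp: eventually_at_filter\<close>)
    thus "(?g \<longlongrightarrow> 0) (at_right 0)" by simp
  qed
  have lim1: "((ereal \<circ> ?g \<circ> real_of_ereal) \<longlongrightarrow> 1) (at_left 1)"
    unfolding one_ereal_def ereal_tendsto_simps
  proof -
    have "(?g \<longlongrightarrow> 1 powr (1 / \<beta>)) (at_left 1)"
      by (rule tendsto_powr'[OF tendsto_ident_at tendsto_const]) auto
    thus "(?g \<longlongrightarrow> 1) (at_left 1)" by simp
  qed
  note subst = interval_integral_substitution_nonneg[where f = ?f and g = ?g and g' = ?g',
      OF _ deriv contf contg' f_nonneg g'_nonneg lim0 lim1, unfolded eins, OF _ _ _ _ _ _ _ int']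
  have "set_integrable lborel {0<..<1} ?f" by (rule subst) simp_all
  moreover have "(LBINT x=0..1. ?f x) = (LBINT t=0..1. ?f (?g t) * ?g' t)"
    by (rule subst) simp_all
  moreover have "(LBINT t:{0<..<1}. ?f (?g t) * ?g' t) = (LBINT t:{0<..<1}. 2 * \<alpha> * I t)"
    using fg by (intro set_lebesgue_integral_cong) auto
  ultimately show "set_integrable lborel {0<..<1} ?f"
    "inverted_moment (rtuomg_density \<alpha> \<beta> p) r = 2 * \<alpha> * (LBINT t:{0<..<1}. I t)"
    by (simp_all add: eins inverted_moment_def interval_lebesgue_integral_def)
qed

section \<open>The inverted moments\<close>

theorem proposition2p3:
  fixes \<alpha> \<beta> p r :: real and M :: "'a measure" and X :: "'a \<Rightarrow> real"
  assumes "\<alpha> > 0" and "\<beta> > 0" and "0 \<le> p" and "p \<le> 1"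
    and "prob_space M"
    and "distributed M lborel X (\<lambda>x. ennreal (rtuomg_density \<alpha> \<beta> p x))"
    and "r < \<beta> \<or> p = 1 \<and> r < 2 * \<beta>"
  shows "set_integrable lborel {0<..<1} (\<lambda>x. x powr (- r) * rtuomg_density \<alpha> \<beta> p x) \<and>
    (\<lambda>k::nat. 1 / (2 * of_nat k - 1) * complex_of_real (Beta (2 * real k - r / \<beta>) \<alpha>)
         * hyp2F1 (of_real (\<alpha> + 1)) (of_real (2 * real k - r / \<beta>))
             (of_real (2 * real k - r / \<beta> + \<alpha>)) (- 1)) summable_on {1..} \<and>
    complex_of_real (inverted_moment (rtuomg_density \<alpha> \<beta> p) r) =
      2 * of_real \<alpha> * (1 - of_real p) * of_real (Beta (1 - r / \<beta>) \<alpha>)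
        * hyp2F1 (of_real (\<alpha> + 1)) (of_real (1 - r / \<beta>)) (of_real (1 - r / \<beta> + \<alpha>)) (- 1)
      + 4 * of_real p * (of_real \<alpha>)\<^sup>2 *
        (\<Sum>\<^sub>\<infinity>k::nat\<in>{1..}. 1 / (2 * of_nat k - 1) * of_real (Beta (2 * real k - r / \<beta>) \<alpha>)
         * hyp2F1 (of_real (\<alpha> + 1)) (of_real (2 * real k - r / \<beta>))
             (of_real (2 * real k - r / \<beta> + \<alpha>)) (- 1))"
proof -
  note pos = assms(1-4)
  define s where "s = r / \<beta>"
  have s: "s < 2" "s < 1 \<or> p = 1"
    using assms(2,7) by (auto simp: s_def pos_divide_less_eq)
  define w where "w = (\<lambda>t::real. t powr (1 - s - 1) * (1 - t) powr (\<alpha> - 1) * (1 + t) powr (- (\<alpha> + 1)))"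
  define l where "l = (\<lambda>t::real. ln ((1 + t) / (1 - t)))"
  define T where "T = (\<lambda>k. 1 / real (2 * k + 1) * (LBINT t:{0<..<1}.
      t powr (1 - s + real (2 * k + 1) - 1) * (1 - t) powr (\<alpha> - 1) * (1 + t) powr (- (\<alpha> + 1))))"
  define A where "A = complex_of_real (Beta (1 - s) \<alpha>) *
      hyp2F1 (of_real (\<alpha> + 1)) (of_real (1 - s)) (of_real (1 - s + \<alpha>)) (- 1)"
  define c where "c = (\<lambda>k::nat. 1 / (2 * of_nat k - 1) * complex_of_real (Beta (2 * real k - s) \<alpha>)
         * hyp2F1 (of_real (\<alpha> + 1)) (of_real (2 * real k - s)) (of_real (2 * real k - s + \<alpha>)) (- 1))"

  \<comment> \<open>For \<open>p = 1\<close> the exponent \<open>- s\<close> of \<open>t\<close> may be \<open>-1\<close> or less and \<open>w\<close> itself not integrable;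
      the factor \<open>1 - p\<close> is therefore kept, here and in \<open>W\<close>.\<close>
  have w_int: "set_integrable lborel {0<..<1} (\<lambda>t. (1 - p) * w t)"
  proof (cases "p = 1")
    case False
    thus ?thesis using set_integrable_Beta_weight[of "1 - s" \<alpha> "\<alpha> + 1"] s pos
      unfolding w_def by (intro set_integrable_mult_right) auto
  qed (simp add: set_integrable_def)
  have wl_int: "set_integrable lborel {0<..<1} (\<lambda>t. w t * l t)"
    using set_integrable_Beta_weight_ln[of "1 - s" \<alpha> "\<alpha> + 1"] s pos unfolding w_def l_def by simp
  define I where "I = (\<lambda>t. w t * (1 - p + p * \<alpha> * l t))"
  have I_eq: "I = (\<lambda>t. (1 - p) * w t + p * \<alpha> * (w t * l t))"
    by (simp add: I_def algebra_simps)
  have wl_int': "set_integrable lborel {0<..<1} (\<lambda>t. p * \<alpha> * (w t * l t))"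
    using wl_int by simp
  have I_int: "set_integrable lborel {0<..<1} I"
    unfolding I_eq by (intro set_integral_add w_int wl_int')
  have "I = (\<lambda>t. t powr (1 - r / \<beta> - 1) * (1 - t) powr (\<alpha> - 1) * (1 + t) powr (- (\<alpha> + 1)) *
      (1 - p + p * \<alpha> * ln ((1 + t) / (1 - t))))"
    by (simp only: I_def w_def l_def s_def)
  note moment = inverted_moment_rtuomg_substitution[OF pos, of r, folded this, OF I_int]
  have W: "complex_of_real ((1 - p) * (LBINT t:{0<..<1}. w t)) = (1 - of_real p) * A"
    using Euler_integral_hyp2F1_minus_one[of "1 - s" \<alpha> "\<alpha> + 1"] s pos
    by (cases "p = 1") (auto simp: w_def A_def)
  have "T sums (1 / 2 * (LBINT t:{0<..<1}. w t * l t))"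
    using Beta_weight_ln_sums[of "1 - s" \<alpha> "\<alpha> + 1"] s pos unfolding T_def w_def l_def by simp
  moreover have "T k \<ge> 0" for k
    unfolding T_def set_lebesgue_integral_def
    by (intro mult_nonneg_nonneg Bochner_Integration.integral_nonneg) auto
  ultimately have "(T has_sum (1 / 2 * (LBINT t:{0<..<1}. w t * l t))) UNIV"
    by (rule sums_nonneg_imp_has_sum)
  hence "((\<lambda>k. complex_of_real (T k)) has_sum of_real (1 / 2 * (LBINT t:{0<..<1}. w t * l t))) UNIV"
    by (simp only: has_sum_of_real_iff)
  \<comment> \<open>The series for the logarithm starts at \<open>0\<close> with exponents \<open>2 * k + 1\<close>, while the stated sum
      starts at \<open>1\<close>.\<close>
  moreover have "complex_of_real (T k) = c (Suc k)" for k
  proof -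
    have idx: "2 * real (Suc k) - s = 1 - s + real (2 * k + 1)"
      and fac: "2 * of_nat (Suc k) - 1 = complex_of_real (real (2 * k + 1))" by simp_all
    have "0 < 1 - s + real (2 * k + 1)" using s by simp
    from Euler_integral_hyp2F1_minus_one[OF this pos(1), of "\<alpha> + 1"] show ?thesis
      unfolding c_def idx fac T_def by (simp only: of_real_mult of_real_divide of_real_1 mult.assoc)
  qed
  ultimately have "((\<lambda>k. c (Suc k)) has_sum of_real (1 / 2 * (LBINT t:{0<..<1}. w t * l t))) UNIV"
    by simp
  moreover have "bij_betw Suc UNIV {1..}"
    by (rule bij_betwI[of _ _ _ "\<lambda>k. k - 1"]) auto
  ultimately have c_sum: "(c has_sum of_real (1 / 2 * (LBINT t:{0<..<1}. w t * l t))) {1..}"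
    using has_sum_reindex_bij_betw by blast

  have "inverted_moment (rtuomg_density \<alpha> \<beta> p) r =
      2 * \<alpha> * ((1 - p) * (LBINT t:{0<..<1}. w t) + p * \<alpha> * (LBINT t:{0<..<1}. w t * l t))"
    unfolding moment(2) using set_integral_add(2)[OF w_int wl_int'] by (simp add: I_eq)
  also have "complex_of_real \<dots> = 2 * of_real \<alpha> * ((1 - of_real p) * A) +
      4 * of_real p * (of_real \<alpha>)\<^sup>2 * of_real (1 / 2 * (LBINT t:{0<..<1}. w t * l t))"
    unfolding W[symmetric] by (simp add: algebra_simps power2_eq_square)
  also have "of_real (1 / 2 * (LBINT t:{0<..<1}. w t * l t)) = (\<Sum>\<^sub>\<infinity>k\<in>{1..}. c k)"
    using c_sum by (rule infsumI[symmetric])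
  finally have "complex_of_real (inverted_moment (rtuomg_density \<alpha> \<beta> p) r) =
      2 * of_real \<alpha> * (1 - of_real p) * of_real (Beta (1 - s) \<alpha>) *
        hyp2F1 (of_real (\<alpha> + 1)) (of_real (1 - s)) (of_real (1 - s + \<alpha>)) (- 1) +
      4 * of_real p * (of_real \<alpha>)\<^sup>2 * (\<Sum>\<^sub>\<infinity>k\<in>{1..}. c k)"
    by (simp only: A_def mult.assoc)
  with moment(1) has_sum_imp_summable[OF c_sum] show ?thesis
    unfolding c_def s_def by blast
qed

end
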